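(* Let $n \ge 1$ be an integer, let $A$ and $B$ be any two complex positive semidefinite $n \times n$ matrices, and let $p$ be a positive integer with $p \le 7$. Then the polynomial $\lambda(t) = \operatorname{Tr}\left[(A + tB)^p\right]$ in the variable $t$ has nonnegative coefficients.
   Context: Positive semidefinite complex matrices are understood to be Hermitian. $\operatorname{Tr}$ denotes the matrix trace. For each $r$, the coefficient of $t^r$ in $\lambda(t)$ is the trace of the sum of all words of length $p$ in the letters $A$ and $B$ in which exactly $r$ letters are $B$; "nonnegative" means that each of these coefficients is a real number $\ge 0$. *)

theory Defs
  imports "Jordan_Normal_Form.Schur_Decomposition"
begin

definition mat_trace :: "'a :: comm_monoid_add mat \<Rightarrow> 'a" where
  "mat_trace A = (\<Sum>i<dim_row A. A $$ (i, i))"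

definition hermitian_mat :: "complex mat \<Rightarrow> bool" where
  "hermitian_mat A \<longleftrightarrow> square_mat A \<and> mat_adjoint A = A"

text \<open>The order on complex numbers is the partial order of \<^theory>\<open>HOL-Library.Complex_Order\<close>:
  \<^term>\<open>0 \<le> z\<close> says that \<open>z\<close> is real and nonnegative.  The vector product \<open>\<bullet>c\<close> conjugates its
  second argument, so \<open>(A *\<^sub>v v) \<bullet>c v\<close> is the quadratic form of \<open>A\<close> at \<open>v\<close>.\<close>

definition psd_mat :: "complex mat \<Rightarrow> bool" where
  "psd_mat A \<longleftrightarrow> hermitian_mat A \<and>
     (\<forall>v \<in> carrier_vec (dim_row A). 0 \<le> (A *\<^sub>v v) \<bullet>c v)"

text \<open>The polynomial is formed over \<open>\<complex>[t]\<close>: \<open>A\<close> and \<open>B\<close> are read as matrices of constant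
  polynomials and \<open>t\<close> is the indeterminate \<^term>\<open>[:0, 1:]\<close>.\<close>

definition trace_pow_poly :: "complex mat \<Rightarrow> complex mat \<Rightarrow> nat \<Rightarrow> complex poly" where
  "trace_pow_poly A B p =
     mat_trace ((map_mat (\<lambda>a. [:a:]) A + [:0, 1:] \<cdot>\<^sub>m map_mat (\<lambda>b. [:b:]) B) ^\<^sub>m p)"

lemma poly_trace_pow_poly:
  assumes A: "A \<in> carrier_mat n n" and B: "B \<in> carrier_mat n n"
  shows "poly (trace_pow_poly A B p) t = mat_trace ((A + t \<cdot>\<^sub>m B) ^\<^sub>m p)"
proof -
  have h: "semiring_hom (\<lambda>q :: complex poly. poly q t)"
    by unfold_locales auto
  let ?M = "map_mat (\<lambda>a. [:a:]) A + [:0, 1:] \<cdot>\<^sub>m map_mat (\<lambda>b. [:b:]) B"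
  have M: "?M \<in> carrier_mat n n" using A B by auto
  have ev: "map_mat (\<lambda>q. poly q t) ?M = A + t \<cdot>\<^sub>m B"
    using A B by (intro eq_matI) auto
  have "map_mat (\<lambda>q. poly q t) (?M ^\<^sub>m p) = (A + t \<cdot>\<^sub>m B) ^\<^sub>m p"
    using semiring_hom.mat_hom_pow[OF h M, of p] ev by simp
  moreover have "poly (mat_trace N) t = mat_trace (map_mat (\<lambda>q. poly q t) N)"
    if "N \<in> carrier_mat n n" for N
    using that by (simp add: mat_trace_def poly_sum)
  ultimately show ?thesis using pow_carrier_mat[OF M, of p] unfolding trace_pow_poly_def by metis
qed

end

theory Submission
  imports Defs
begin

text \<open>The coefficient of \<open>t ^ r\<close> is the trace of the sum of all words of length \<open>p\<close> with \<open>r\<close> letters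
  \<open>B\<close>.  Exchanging \<open>A\<close> and \<open>B\<close> replaces \<open>r\<close> by \<open>p - r\<close>, so for \<open>p \<le> 7\<close> it is enough to treat
  \<open>r \<le> 2\<close> and, for \<open>p = 6\<close> and \<open>p = 7\<close>, also \<open>r = 3\<close>.

  By the spectral theorem (\<open>hermitian_diagonalization\<close>) one may take \<open>A\<close> diagonal with eigenvalues
  \<open>a x \<ge> 0\<close>.  The words with \<open>r\<close> letters \<open>B\<close> then sum up to a sum over paths of \<open>r\<close> entries of \<open>B\<close>, in
  which each path is weighted by the divided difference of \<open>t ^ p\<close> at the eigenvalues it visits.
  For \<open>r \<le> 2\<close> every term of the trace is visibly nonnegative.  For \<open>r = 3\<close> the trace is, up to the
  factor \<open>p / 3\<close>, the sum of \<open>b x y * b y z * b z x\<close> with weight \<open>divdiff (p - 1) [a x, a y, a z]\<close>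
  (\<open>cyc_sum_closed_walk\<close>).

  For \<open>p = 7\<close> this cyclic sum comes from the sum of squares
  \<open>X\<^sup>* B X + Y\<^sup>* B Y\<close> with \<open>X = (B A + A B) A\<close> and \<open>Y = A A B\<close> (\<open>cyc_sum_divdiff_6_nonneg\<close>).

  The case \<open>p = 6\<close> is reduced to the case \<open>p = 7\<close> by a flow (\<open>cyc_sum_divdiff_5_nonneg\<close>).
  For \<open>u \<ge> 0\<close> replace \<open>A\<close> by \<open>A (1 + u A)\<^sup>-\<^sup>1\<close> and \<open>B\<close> by the congruent matrix
  \<open>S B S\<close>, where \<open>S\<close> is the positive square root of \<open>(1 + u A)\<^sup>-\<^sup>1\<close>.  Both stay positive
  semidefinite.  The derivative in \<open>u\<close> of the cyclic sum for \<open>p = 6\<close> is \<open>-4\<close> times the cyclic sum for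
  \<open>p = 7\<close>, hence at most zero, and the cyclic sum for \<open>p = 6\<close> tends to zero as \<open>u\<close> grows because the
  new \<open>A\<close> does.  So its value at \<open>u = 0\<close> is at least zero.\<close>

section \<open>Divided differences of powers\<close>

text \<open>The divided difference of the function \<open>t \<mapsto> t ^ p\<close> at the listed nodes, equivalently the
  complete homogeneous symmetric polynomial of degree \<open>p + 1 - length xs\<close> in them, which is zero
  if there are more than \<open>p + 1\<close> nodes.  The recursion
  is the Leibniz rule for \<open>t ^ p * t\<close>; it is the same recursion by which the words of
  \<open>(A + t B) ^ p\<close> grow by one letter when \<open>A\<close> is diagonal.\<close>
fun divdiff :: "nat \<Rightarrow> real list \<Rightarrow> real" where
  "divdiff _ [] = 0"
| "divdiff 0 (x # xs) = (if xs = [] then 1 else 0)"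
| "divdiff (Suc p) (x # xs) = divdiff p (x # xs) * x + divdiff p xs"

lemma divdiff_nonneg: "(\<And>x. x \<in> set xs \<Longrightarrow> 0 \<le> x) \<Longrightarrow> 0 \<le> divdiff p xs"
  by (induction p xs rule: divdiff.induct) auto

section \<open>Cyclic sums over triples of indices\<close>

definition psd_kernel :: "nat \<Rightarrow> (nat \<Rightarrow> nat \<Rightarrow> complex) \<Rightarrow> bool" where
  "psd_kernel n b \<longleftrightarrow> (\<forall>i<n. \<forall>j<n. b j i = cnj (b i j)) \<and>
     (\<forall>v. 0 \<le> (\<Sum>i<n. \<Sum>j<n. cnj (v i) * b i j * v j))"

text \<open>For diagonal \<open>A\<close>, the trace of any real combination of words with three letters \<open>B\<close> has this form,
  the weight \<open>h\<close> being the contribution of the letters \<open>A\<close>.\<close>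
definition cyc_sum :: "nat \<Rightarrow> (nat \<Rightarrow> nat \<Rightarrow> nat \<Rightarrow> real) \<Rightarrow> (nat \<Rightarrow> nat \<Rightarrow> complex) \<Rightarrow> complex" where
  "cyc_sum n h b = (\<Sum>x<n. \<Sum>y<n. \<Sum>z<n. of_real (h x y z) * (b x y * b y z * b z x))"

lemma cyc_sum_rotate: "cyc_sum n (\<lambda>x y z. h y z x) b = cyc_sum n h b"
proof -
  have "cyc_sum n (\<lambda>x y z. h y z x) b
      = (\<Sum>x<n. \<Sum>y<n. \<Sum>z<n. of_real (h y z x) * (b y z * b z x * b x y))"
    unfolding cyc_sum_def by (simp add: ac_simps)
  also have "\<dots> = (\<Sum>y<n. \<Sum>x<n. \<Sum>z<n. of_real (h y z x) * (b y z * b z x * b x y))"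
    by (rule sum.swap)
  also have "\<dots> = (\<Sum>y<n. \<Sum>z<n. \<Sum>x<n. of_real (h y z x) * (b y z * b z x * b x y))"
    by (intro sum.cong refl sum.swap)
  finally show ?thesis unfolding cyc_sum_def .
qed

lemma cyc_sum_rotations:
  "cyc_sum n (\<lambda>x y z. h x y z + h y z x + h z x y) b = 3 * cyc_sum n h b"
proof -
  have "cyc_sum n (\<lambda>x y z. h x y z + h y z x + h z x y) b
      = cyc_sum n h b + cyc_sum n (\<lambda>x y z. h y z x) b + cyc_sum n (\<lambda>x y z. h z x y) b"
    unfolding cyc_sum_def of_real_add distrib_right sum.distrib by (rule refl)
  also have "cyc_sum n (\<lambda>x y z. h z x y) b = cyc_sum n h b"
    using cyc_sum_rotate[of n "\<lambda>x y z. h y z x" b] cyc_sum_rotate[of n h b] by simp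
  also have "cyc_sum n (\<lambda>x y z. h y z x) b = cyc_sum n h b"
    by (rule cyc_sum_rotate)
  finally show ?thesis by simp
qed

lemma cyc_sum_scale: "cyc_sum n (\<lambda>x y z. c * h x y z) b = of_real c * cyc_sum n h b"
  unfolding cyc_sum_def sum_distrib_left of_real_mult mult.assoc by (rule refl)

text \<open>The cyclic sum does not change when its weight is rotated, so three times the left sum has as
  weight the sum of the three rotations.  The derivative of a divided difference in a node doubles
  that node, so this weight is the derivative of \<open>divdiff p [x, y, z]\<close> under a simultaneous shift
  of all nodes, and this turns \<open>t ^ p\<close> into \<open>p * t ^ (p - 1)\<close>.\<close>
lemma cyc_sum_closed_walk:
  assumes "p = 6 \<or> p = 7"
  shows "3 * cyc_sum n (\<lambda>x y z. divdiff p [a x, a z, a y, a x]) b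
       = of_nat p * cyc_sum n (\<lambda>x y z. divdiff (p - 1) [a x, a y, a z]) b"
proof -
  have "divdiff p [a x, a z, a y, a x] + divdiff p [a y, a x, a z, a y]
      + divdiff p [a z, a y, a x, a z] = real p * divdiff (p - 1) [a x, a y, a z]" for x y z
    using assms by (elim disjE) (simp_all add: numeral_eq_Suc, simp_all add: algebra_simps)
  then show ?thesis
    unfolding cyc_sum_rotations[symmetric] by (simp add: cyc_sum_scale)
qed

lemma divdiff_5: "divdiff 5 [x, y, z]
    = x ^ 3 + y ^ 3 + z ^ 3 + x ^ 2 * (y + z) + y ^ 2 * (x + z) + z ^ 2 * (x + y) + x * y * z"
  by (simp add: numeral_eq_Suc) (simp add: algebra_simps)

lemma divdiff_6: "divdiff 6 [x, y, z]
    = x ^ 4 + y ^ 4 + z ^ 4 + x ^ 3 * (y + z) + y ^ 3 * (x + z) + z ^ 3 * (x + y)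
      + x ^ 2 * y ^ 2 + y ^ 2 * z ^ 2 + x ^ 2 * z ^ 2 + x * y * z * (x + y + z)"
  by (simp add: numeral_eq_Suc) (simp add: algebra_simps)

text \<open>In terms of words with four letters \<open>A\<close> and three letters \<open>B\<close>, the sum over all of them has,
  up to a factor, the same trace as \<open>X\<^sup>* B X + Y\<^sup>* B Y\<close> with \<open>X = (B A + A B) A\<close> and
  \<open>Y = A A B\<close>.  The weight below is read off from these two products for diagonal \<open>A\<close>; for fixed
  \<open>x\<close> each of them is a value of the quadratic form of \<open>b\<close>, and the three rotations of the weight
  add up to \<open>divdiff 6\<close>.\<close>
lemma cyc_sum_divdiff_6_nonneg:
  assumes b: "psd_kernel n b"
  shows "0 \<le> cyc_sum n (\<lambda>x y z. divdiff 6 [a x, a y, a z]) b"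
proof -
  let ?h = "\<lambda>x y z. a x ^ 2 * (a x + a y) * (a x + a z) + a y ^ 2 * a z ^ 2"
  have herm: "cnj (b i j) = b j i" if "i < n" "j < n" for i j
    using b that unfolding psd_kernel_def by metis
  have q: "0 \<le> (\<Sum>y<n. \<Sum>z<n. of_real (f y * f z) * (b x y * b y z * b z x))" if "x < n" for x f
  proof -
    \<comment> \<open>the quadratic form is evaluated at column \<open>x\<close> of \<open>b\<close>, rescaled entrywise by \<open>f\<close>\<close>
    have "0 \<le> (\<Sum>y<n. \<Sum>z<n. cnj (of_real (f y) * b y x) * b y z * (of_real (f z) * b z x))"
      using b unfolding psd_kernel_def by (elim conjE allE[of _ "\<lambda>y. of_real (f y) * b y x"])
    also have "\<dots> = (\<Sum>y<n. \<Sum>z<n. of_real (f y * f z) * (b x y * b y z * b z x))"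
      using that by (intro sum.cong refl) (simp add: herm ac_simps)
    finally show ?thesis .
  qed
  have "0 \<le> (\<Sum>x<n. (\<Sum>y<n. \<Sum>z<n. of_real ((a x * (a x + a y)) * (a x * (a x + a z))) * (b x y * b y z * b z x))
       + (\<Sum>y<n. \<Sum>z<n. of_real (a y ^ 2 * a z ^ 2) * (b x y * b y z * b z x)))"
    by (intro sum_nonneg add_nonneg_nonneg q) auto
  also have "\<dots> = cyc_sum n ?h b"
    unfolding cyc_sum_def sum.distrib[symmetric]
    by (intro sum.cong refl) (simp add: algebra_simps power2_eq_square)
  finally have "0 \<le> 3 * cyc_sum n ?h b" by (simp add: less_eq_complex_def)
  also have "\<dots> = cyc_sum n (\<lambda>x y z. divdiff 6 [a x, a y, a z]) b"
  proof -
    have "?h x y z + ?h y z x + ?h z x y = divdiff 6 [a x, a y, a z]" for x y z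
      unfolding divdiff_6 by (simp add: numeral_eq_Suc algebra_simps)
    then show ?thesis unfolding cyc_sum_rotations[symmetric] by simp
  qed
  finally show ?thesis .
qed

lemma psd_kernel_scale:
  assumes "psd_kernel n b"
  shows "psd_kernel n (\<lambda>i j. of_real (s i) * b i j * of_real (s j))"
proof -
  have "0 \<le> (\<Sum>i<n. \<Sum>j<n. cnj (v i) * (of_real (s i) * b i j * of_real (s j)) * v j)" for v
  proof -
    have "0 \<le> (\<Sum>i<n. \<Sum>j<n. cnj (of_real (s i) * v i) * b i j * (of_real (s j) * v j))"
      using assms unfolding psd_kernel_def by (elim conjE allE[of _ "\<lambda>i. of_real (s i) * v i"])
    then show ?thesis by (simp add: ac_simps)
  qed
  moreover have "of_real (s j) * b j i * of_real (s i) = cnj (of_real (s i) * b i j * of_real (s j))"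
    if "i < n" "j < n" for i j
  proof -
    have "b j i = cnj (b i j)"
      using assms that unfolding psd_kernel_def by blast
    then show ?thesis by (simp only: complex_cnj_mult complex_cnj_complex_of_real mult.commute mult.left_commute)
  qed
  ultimately show ?thesis unfolding psd_kernel_def by blast
qed

section \<open>Descent from degree six to degree five\<close>

text \<open>Along the flow \<open>A' = - A\<^sup>2\<close>, \<open>B' = - (A B + B A) / 2\<close> the derivative of a word trace is a
  combination of traces of words with one more letter \<open>A\<close>.  For diagonal \<open>A\<close> the flow is explicit:
  \<open>P\<close> is the factor by which an eigenvalue \<open>x\<close> of \<open>A\<close> has shrunk at time \<open>u\<close>.\<close>
lemma DERIV_divdiff_flow:
  fixes x y z u :: real
  assumes "0 \<le> x" "0 \<le> y" "0 \<le> z" "0 \<le> u"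
  defines "P \<equiv> \<lambda>x u. 1 / (1 + u * x)"
  shows "((\<lambda>u. divdiff 5 [x * P x u, y * P y u, z * P z u] * (P x u * P y u * P z u))
     has_real_derivative
       - 4 * (divdiff 6 [x * P x u, y * P y u, z * P z u] * (P x u * P y u * P z u))) (at u)"
proof -
  have P: "(P x has_real_derivative - (x * P x u) * P x u) (at u)" if "0 \<le> x" for x
  proof -
    have "1 + u * x \<noteq> 0" using that assms by (smt (verit) mult_nonneg_nonneg)
    then show ?thesis unfolding P_def
      by (auto intro!: derivative_eq_intros simp: power2_eq_square)
  qed
  have X: "((\<lambda>u. x * P x u) has_real_derivative - ((x * P x u) ^ 2)) (at u)" if "0 \<le> x" for x
    using DERIV_cmult[OF P[OF that], of x] by (simp add: power2_eq_square ac_simps)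
  define X Y Z where "X = x * P x u" and "Y = y * P y u" and "Z = z * P z u"
  note D = P[OF assms(1)] P[OF assms(2)] P[OF assms(3)] X[OF assms(1)] X[OF assms(2)] X[OF assms(3)]
  note D = D[folded X_def Y_def Z_def]
  show ?thesis
    unfolding divdiff_5 divdiff_6
    apply (rule DERIV_cong)
     apply (rule D DERIV_mult DERIV_add DERIV_power)+
    apply (simp add: X_def[symmetric] Y_def[symmetric] Z_def[symmetric])
    apply (simp add: numeral_eq_Suc algebra_simps)
    done
qed

lemma tendsto_divdiff_flow:
  fixes x y z :: real
  assumes "0 \<le> x" "0 \<le> y" "0 \<le> z"
  defines "P \<equiv> \<lambda>x u. 1 / (1 + u * x)"
  shows "((\<lambda>u. divdiff 5 [x * P x u, y * P y u, z * P z u] * (P x u * P y u * P z u)) \<longlongrightarrow> 0) at_top"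
proof -
  have P: "(P x \<longlongrightarrow> (if x = 0 then 1 else 0)) at_top" if "0 \<le> x" for x
  proof (cases "x = 0")
    case False
    then have "0 < x" using that by simp
    have "filterlim (\<lambda>u. 1 + u * x) at_top at_top"
      by (intro filterlim_tendsto_add_at_top[OF tendsto_const] filterlim_at_top_mult_tendsto_pos[OF tendsto_const \<open>0 < x\<close>] filterlim_ident)
    then show ?thesis using False unfolding P_def
      by (auto intro!: tendsto_divide_0[OF tendsto_const] filterlim_at_top_imp_at_infinity)
  qed (simp add: P_def)
  have X: "((\<lambda>u. x * P x u) \<longlongrightarrow> 0) at_top" if "0 \<le> x" for x
    using tendsto_mult_left[OF P[OF that], of x] by (cases "x = 0") auto
  note L = P[OF assms(1)] P[OF assms(2)] P[OF assms(3)] X[OF assms(1)] X[OF assms(2)] X[OF assms(3)]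
  show ?thesis
    unfolding divdiff_5
    apply (rule tendsto_eq_rhs)
    apply (rule L tendsto_mult tendsto_add tendsto_power)+
    apply simp
    done
qed

lemma cnj_cyc_sum:
  assumes "psd_kernel n b"
  shows "cnj (cyc_sum n h b) = cyc_sum n (\<lambda>x y z. h x z y) b"
proof -
  have herm: "cnj (b i j) = b j i" if "i < n" "j < n" for i j
    using assms that unfolding psd_kernel_def by metis
  have "cnj (cyc_sum n h b) = (\<Sum>x<n. \<Sum>y<n. \<Sum>z<n. of_real (h x y z) * (b x z * b z y * b y x))"
    unfolding cyc_sum_def by (simp add: herm ac_simps)
  also have "\<dots> = (\<Sum>x<n. \<Sum>z<n. \<Sum>y<n. of_real (h x y z) * (b x z * b z y * b y x))"
    by (intro sum.cong refl sum.swap)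
  finally show ?thesis unfolding cyc_sum_def .
qed

lemma cyc_sum_rescale:
  "cyc_sum n h (\<lambda>i j. of_real (s i) * b i j * of_real (s j))
     = cyc_sum n (\<lambda>x y z. h x y z * ((s x)\<^sup>2 * (s y)\<^sup>2 * (s z)\<^sup>2)) b"
  unfolding cyc_sum_def by (simp add: power2_eq_square ac_simps)

lemma Re_cyc_sum:
  "Re (cyc_sum n h b) = (\<Sum>x<n. \<Sum>y<n. \<Sum>z<n. h x y z * Re (b x y * b y z * b z x))"
  unfolding cyc_sum_def by simp

text \<open>Along the flow started at \<open>(A, B)\<close> positivity is preserved, so the cyclic sum for \<open>divdiff 5\<close> has derivative \<open>-4\<close> times a nonnegative cyclic sum
  for \<open>divdiff 6\<close>, and it tends to zero at infinity.  A nonincreasing function with limit zero is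
  nonnegative at the start.\<close>
lemma cyc_sum_divdiff_5_nonneg:
  assumes b: "psd_kernel n b" and a: "\<And>i. 0 \<le> a i"
  shows "0 \<le> cyc_sum n (\<lambda>x y z. divdiff 5 [a x, a y, a z]) b"
proof -
  define P :: "real \<Rightarrow> real \<Rightarrow> real" where "P = (\<lambda>x u. 1 / (1 + u * x))"
  define T where "T p u = cyc_sum n (\<lambda>x y z. divdiff p [a x * P (a x) u, a y * P (a y) u, a z * P (a z) u]
      * (P (a x) u * P (a y) u * P (a z) u)) b" for p u
  have T6: "0 \<le> T 6 u" if "0 \<le> u" for u
  proof -
    \<comment> \<open>each index of a triple occurs in two of the three factors \<open>b\<close>, so scaling rows and
      columns by square roots scales the triple by all three values of \<open>P\<close>\<close>
    have "(sqrt (P (a i) u))\<^sup>2 = P (a i) u" for i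
      using a[of i] that unfolding P_def by simp
    then show ?thesis
      using cyc_sum_divdiff_6_nonneg[OF psd_kernel_scale[OF b, of "\<lambda>i. sqrt (P (a i) u)"], of "\<lambda>i. a i * P (a i) u"]
      unfolding cyc_sum_rescale T_def by simp
  qed
  have deriv: "((\<lambda>u. Re (T 5 u)) has_real_derivative - 4 * Re (T 6 u)) (at u)" if "0 \<le> u" for u
  proof -
    have "((\<lambda>u. Re (T 5 u)) has_real_derivative
        (\<Sum>x<n. \<Sum>y<n. \<Sum>z<n. (- 4 * (divdiff 6 [a x * P (a x) u, a y * P (a y) u, a z * P (a z) u]
          * (P (a x) u * P (a y) u * P (a z) u))) * Re (b x y * b y z * b z x))) (at u)"
      unfolding T_def Re_cyc_sum P_def
      by (intro DERIV_sum DERIV_cmult_right DERIV_divdiff_flow a that)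
    then show ?thesis
      unfolding T_def Re_cyc_sum sum_distrib_left mult.assoc .
  qed
  have "((\<lambda>u. Re (T 5 u)) \<longlongrightarrow> (\<Sum>x<n. \<Sum>y<n. \<Sum>z<n. 0 * Re (b x y * b y z * b z x))) at_top"
    unfolding T_def Re_cyc_sum P_def
    by (intro tendsto_sum tendsto_mult_right tendsto_divdiff_flow a)
  then have "((\<lambda>u. Re (T 5 u)) \<longlongrightarrow> 0) at_top"
    by simp
  moreover have "eventually (\<lambda>u. Re (T 5 u) \<le> Re (T 5 0)) at_top"
    using eventually_ge_at_top[of 0]
  proof eventually_elim
    case (elim u)
    show ?case
    proof (rule DERIV_nonpos_imp_nonincreasing[OF elim], intro exI conjI)
      fix w :: real assume "0 \<le> w" "w \<le> u"
      then show "((\<lambda>u. Re (T 5 u)) has_real_derivative - 4 * Re (T 6 w)) (at w)" "- 4 * Re (T 6 w) \<le> 0"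
        using deriv T6[of w] by (auto simp: less_eq_complex_def)
    qed
  qed
  ultimately have "0 \<le> Re (T 5 0)"
    by (rule tendsto_upperbound) simp
  moreover have "T 5 0 = cyc_sum n (\<lambda>x y z. divdiff 5 [a x, a y, a z]) b"
    unfolding T_def P_def by simp
  moreover have "Im (T 5 0) = 0"
  proof -
    \<comment> \<open>conjugation reverses the direction of the cycle, under which a symmetric weight is invariant\<close>
    have "divdiff 5 [x, z, y] = divdiff 5 [x, y, z]" for x y z
      unfolding divdiff_5 by simp
    then have "cnj (T 5 0) = T 5 0"
      unfolding T_def P_def cnj_cyc_sum[OF b] by simp
    then show ?thesis
      by (simp add: complex_eq_iff)
  qed
  ultimately show ?thesis
    by (simp add: less_eq_complex_def)
qed

section \<open>Coefficients of the trace polynomial as sums over words\<close>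

text \<open>The \<open>(x, y)\<close> entry of the sum of all words of length \<open>p\<close> in the \<open>n\<close> by \<open>n\<close> matrices \<open>a\<close> and
  \<open>b\<close> with exactly \<open>r\<close> letters \<open>b\<close>; the recursion splits off the last letter.\<close>
fun word_sum :: "nat \<Rightarrow> (nat \<Rightarrow> nat \<Rightarrow> 'a :: comm_ring_1) \<Rightarrow> (nat \<Rightarrow> nat \<Rightarrow> 'a) \<Rightarrow> nat \<Rightarrow> nat \<Rightarrow> nat \<Rightarrow> nat \<Rightarrow> 'a" where
  "word_sum n a b 0 r x y = (if r = 0 \<and> x = y then 1 else 0)"
| "word_sum n a b (Suc p) 0 x y = (\<Sum>z<n. word_sum n a b p 0 x z * a z y)"
| "word_sum n a b (Suc p) (Suc r) x y =
     (\<Sum>z<n. word_sum n a b p (Suc r) x z * a z y) + (\<Sum>z<n. word_sum n a b p r x z * b z y)"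

lemma coeff_trace_pow_poly:
  assumes A: "A \<in> carrier_mat n n" and B: "B \<in> carrier_mat n n"
  shows "coeff (trace_pow_poly A B p) r
    = (\<Sum>x<n. word_sum n (\<lambda>i j. A $$ (i, j)) (\<lambda>i j. B $$ (i, j)) p r x x)"
proof -
  define M where "M = map_mat (\<lambda>a. [:a:]) A + [:0, 1:] \<cdot>\<^sub>m map_mat (\<lambda>b. [:b:]) B"
  have M: "M \<in> carrier_mat n n"
    using A B unfolding M_def by auto
  note Mp = pow_carrier_mat[OF M]
  have entry: "coeff ((M ^\<^sub>m p) $$ (x, y)) r
      = word_sum n (\<lambda>i j. A $$ (i, j)) (\<lambda>i j. B $$ (i, j)) p r x y" if "x < n" "y < n" for x y
    using that
  proof (induction n\<equiv>n a\<equiv>"\<lambda>i j. A $$ (i, j)" b\<equiv>"\<lambda>i j. B $$ (i, j)" p r x y rule: word_sum.induct)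
    case (1 r x y)
    then show ?case using M by (simp add: coeff_1)
  next
    case (2 p x y)
    have "(M ^\<^sub>m Suc p) $$ (x, y) = (\<Sum>z<n. (M ^\<^sub>m p) $$ (x, z) * [:A $$ (z, y), B $$ (z, y):])"
      using M Mp[of p] A B 2 by (simp add: scalar_prod_def M_def atLeast0LessThan)
    then show ?case using 2 by (simp add: coeff_sum mult.commute)
  next
    case (3 p r x y)
    have "(M ^\<^sub>m Suc p) $$ (x, y) = (\<Sum>z<n. (M ^\<^sub>m p) $$ (x, z) * [:A $$ (z, y), B $$ (z, y):])"
      using M Mp[of p] A B 3 by (simp add: scalar_prod_def M_def atLeast0LessThan)
    then show ?case using 3
      by (simp add: coeff_sum sum.distrib mult.commute)
  qed
  show ?thesis
    unfolding trace_pow_poly_def M_def[symmetric] mat_trace_def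
    using Mp[of p] carrier_matD[OF M] by (simp add: coeff_sum entry)
qed

lemma word_sum_eq_0: "p < r \<Longrightarrow> word_sum n a b p r x y = 0"
  by (induction n a b p r x y rule: word_sum.induct) auto

lemma word_sum_cong:
  assumes "\<And>i j. i < n \<Longrightarrow> j < n \<Longrightarrow> a i j = a' i j"
  shows "y < n \<Longrightarrow> word_sum n a b p r x y = word_sum n a' b p r x y"
proof (induction p arbitrary: r y)
  case (Suc p)
  then show ?case by (cases r) (simp_all add: assms)
qed simp

lemma word_sum_swap: "r \<le> p \<Longrightarrow> word_sum n a b p r x y = word_sum n b a p (p - r) x y"
proof (induction n a b p r x y rule: word_sum.induct)
  case (2 n a b p x y)
  then show ?case by (simp add: word_sum_eq_0)
next
  case (3 n a b p r x y)
  show ?case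
  proof (cases "r = p")
    case False
    then have "Suc p - Suc r = Suc (p - Suc r)" "p - r = Suc (p - Suc r)" "Suc r \<le> p"
      using 3 by auto
    then show ?thesis using 3 by simp
  qed (use 3 in \<open>simp add: word_sum_eq_0\<close>)
qed simp

definition diag :: "(nat \<Rightarrow> real) \<Rightarrow> nat \<Rightarrow> nat \<Rightarrow> complex" where
  "diag a i j = (if i = j then of_real (a i) else 0)"

lemma sum_mult_diag: "y < n \<Longrightarrow> (\<Sum>z<n. f z * diag a z y) = f y * of_real (a y)"
  unfolding diag_def by (simp add: if_distrib[of "\<lambda>c. _ * c"] cong: if_cong)

lemma word_sum_diag_Suc:
  assumes "y < n"
  shows "word_sum n (diag a) b (Suc p) (Suc r) x y
    = word_sum n (diag a) b p (Suc r) x y * of_real (a y) + (\<Sum>z<n. word_sum n (diag a) b p r x z * b z y)"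
  using assms by (simp add: sum_mult_diag)

lemma word_sum_diag_0:
  "x < n \<Longrightarrow> y < n \<Longrightarrow> word_sum n (diag a) b p 0 x y = (if x = y then of_real (divdiff p [a x]) else 0)"
  by (induction p arbitrary: y) (auto simp: sum_mult_diag)

lemma word_sum_diag_1:
  "x < n \<Longrightarrow> y < n \<Longrightarrow> word_sum n (diag a) b p 1 x y = of_real (divdiff p [a y, a x]) * b x y"
proof (induction p arbitrary: y)
  case (Suc p)
  have "(\<Sum>z<n. word_sum n (diag a) b p 0 x z * b z y) = of_real (divdiff p [a x]) * b x y"
    using Suc.prems by (simp add: word_sum_diag_0 if_distrib[of "\<lambda>c. c * _"] cong: if_cong)
  then show ?case
    unfolding One_nat_def word_sum_diag_Suc[OF Suc.prems(2)] using Suc by (simp add: algebra_simps)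
qed simp

lemma word_sum_diag_2:
  "x < n \<Longrightarrow> y < n \<Longrightarrow> word_sum n (diag a) b p 2 x y
     = (\<Sum>z<n. of_real (divdiff p [a y, a z, a x]) * (b x z * b z y))"
proof (induction p arbitrary: y)
  case (Suc p)
  have "word_sum n (diag a) b (Suc p) 2 x y
      = word_sum n (diag a) b p 2 x y * of_real (a y) + (\<Sum>z<n. word_sum n (diag a) b p 1 x z * b z y)"
    using word_sum_diag_Suc[OF Suc.prems(2), of a b p 1 x] by (simp add: numeral_2_eq_2)
  also have "(\<Sum>z<n. word_sum n (diag a) b p 1 x z * b z y)
      = (\<Sum>z<n. of_real (divdiff p [a z, a x]) * (b x z * b z y))"
    using Suc.prems by (intro sum.cong refl) (simp only: word_sum_diag_1 lessThan_iff mult.assoc)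
  finally show ?case
    using Suc by (simp add: sum_distrib_left sum_distrib_right sum.distrib algebra_simps)
qed simp

lemma word_sum_diag_3:
  "x < n \<Longrightarrow> y < n \<Longrightarrow> word_sum n (diag a) b p 3 x y
     = (\<Sum>z<n. \<Sum>w<n. of_real (divdiff p [a y, a w, a z, a x]) * (b x z * b z w * b w y))"
proof (induction p arbitrary: y)
  case (Suc p)
  have "(\<Sum>w<n. word_sum n (diag a) b p 2 x w * b w y)
      = (\<Sum>z<n. \<Sum>w<n. of_real (divdiff p [a w, a z, a x]) * (b x z * b z w * b w y))"
    by (subst sum.swap) (simp add: word_sum_diag_2 Suc.prems sum_distrib_right mult.assoc)
  moreover have "word_sum n (diag a) b (Suc p) 3 x y
      = word_sum n (diag a) b p 3 x y * of_real (a y) + (\<Sum>z<n. word_sum n (diag a) b p 2 x z * b z y)"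
    using word_sum_diag_Suc[OF Suc.prems(2), of a b p 2 x] by (simp add: numeral_3_eq_3 numeral_2_eq_2)
  ultimately show ?case
    using Suc by (simp add: sum_distrib_left sum_distrib_right sum.distrib algebra_simps)
qed simp

lemma psd_kernel_diag_nonneg:
  assumes "psd_kernel n b" "x < n"
  shows "0 \<le> b x x"
proof -
  have "0 \<le> (\<Sum>i<n. \<Sum>j<n. cnj (if i = x then 1 else 0) * b i j * (if j = x then 1 else 0))"
    using assms(1) unfolding psd_kernel_def by (elim conjE allE[of _ "\<lambda>i. if i = x then 1 else 0"])
  also have "\<dots> = b x x"
    using assms(2) by (simp add: if_distrib[of "\<lambda>c. _ * c"] if_distrib[of "\<lambda>c. c * _"] if_distrib[of cnj] cong: if_cong)
  finally show ?thesis .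
qed

lemma of_real_mult_nonneg: "0 \<le> c \<Longrightarrow> 0 \<le> z \<Longrightarrow> 0 \<le> of_real c * (z :: complex)"
  by (simp add: less_eq_complex_def)

text \<open>With one or two letters \<open>B\<close> the trace is a combination, with nonnegative weights, of diagonal
  entries \<open>b x x\<close> or of products \<open>b x z * b z x\<close>, which are squared absolute values.  Three letters
  lead to the cyclic sums.\<close>
lemma trace_word_sum_diag_nonneg:
  assumes b: "psd_kernel n b" and a: "\<And>i. 0 \<le> a i"
    and r: "r \<le> 2 \<or> r = 3 \<and> (p = 6 \<or> p = 7)"
  shows "0 \<le> (\<Sum>x<n. word_sum n (diag a) b p r x x)"
proof -
  consider "r = 0" | "r = 1" | "r = 2" | "r = 3" "p = 6 \<or> p = 7"
    using r by linarith
  then show ?thesis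
  proof cases
    case 1
    then show ?thesis
      by (auto intro!: sum_nonneg divdiff_nonneg simp: word_sum_diag_0 a less_eq_complex_def)
  next
    case 2
    then show ?thesis
      by (auto intro!: sum_nonneg of_real_mult_nonneg divdiff_nonneg psd_kernel_diag_nonneg[OF b]
          simp: word_sum_diag_1[simplified] a)
  next
    case 3
    have "0 \<le> b x z * b z x" if "x < n" "z < n" for x z
    proof -
      have "b z x = cnj (b x z)"
        using b that unfolding psd_kernel_def by blast
      then show ?thesis
        by (simp add: complex_mult_cnj less_eq_complex_def)
    qed
    with 3 show ?thesis
      by (auto intro!: sum_nonneg of_real_mult_nonneg divdiff_nonneg simp: word_sum_diag_2 a)
  next
    case 4
    have "(\<Sum>x<n. word_sum n (diag a) b p r x x)
        = cyc_sum n (\<lambda>x y z. divdiff p [a x, a z, a y, a x]) b"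
      unfolding cyc_sum_def 4(1) by (simp add: word_sum_diag_3)
    moreover have "0 \<le> cyc_sum n (\<lambda>x y z. divdiff (p - 1) [a x, a y, a z]) b"
      using 4(2) cyc_sum_divdiff_5_nonneg[OF b a] cyc_sum_divdiff_6_nonneg[OF b] by auto
    ultimately have "0 \<le> 3 * (\<Sum>x<n. word_sum n (diag a) b p r x x)"
      using cyc_sum_closed_walk[OF 4(2), of n a b] of_real_mult_nonneg[of "real p"] by simp
    then show ?thesis
      by (simp add: less_eq_complex_def)
  qed
qed

section \<open>Unitary diagonalization of Hermitian matrices\<close>

lemma mat_adjoint_carrier:
  "A \<in> carrier_mat n m \<Longrightarrow> mat_adjoint A \<in> carrier_mat m n"
  unfolding mat_adjoint_def by (auto simp: mat_of_rows_def)

lemma index_mat_adjoint: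
  "A \<in> carrier_mat n m \<Longrightarrow> i < m \<Longrightarrow> j < n \<Longrightarrow> mat_adjoint A $$ (i, j) = conjugate (A $$ (j, i))"
  unfolding mat_adjoint_def by (auto simp: mat_of_rows_def)

lemma index_adjoint_mult:
  fixes U V :: "complex mat"
  assumes "U \<in> carrier_mat n n" "V \<in> carrier_mat n n" "i < n" "j < n"
  shows "(mat_adjoint U * V) $$ (i, j) = (\<Sum>k<n. cnj (U $$ (k, i)) * V $$ (k, j))"
  using assms mat_adjoint_carrier[OF assms(1)]
  by (simp add: scalar_prod_def index_mat_adjoint atLeast0LessThan)

lemma index_adjoint_mult_mult:
  fixes U A V :: "complex mat"
  assumes "U \<in> carrier_mat n n" "A \<in> carrier_mat n n" "V \<in> carrier_mat n n" "i < n" "j < n"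
  shows "(mat_adjoint U * A * V) $$ (i, j) = (\<Sum>k<n. \<Sum>l<n. cnj (U $$ (k, i)) * A $$ (k, l) * V $$ (l, j))"
proof -
  have "(mat_adjoint U * A * V) $$ (i, j) = (\<Sum>l<n. (mat_adjoint U * A) $$ (i, l) * V $$ (l, j))"
    using assms mat_adjoint_carrier[OF assms(1)] by (simp add: scalar_prod_def atLeast0LessThan del: assoc_mult_mat)
  also have "\<dots> = (\<Sum>l<n. \<Sum>k<n. cnj (U $$ (k, i)) * A $$ (k, l) * V $$ (l, j))"
    using assms by (simp add: index_adjoint_mult sum_distrib_right)
  also have "\<dots> = (\<Sum>k<n. \<Sum>l<n. cnj (U $$ (k, i)) * A $$ (k, l) * V $$ (l, j))"
    by (rule sum.swap)
  finally show ?thesis .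
qed

lemma adjoint_mult:
  fixes U V :: "complex mat"
  assumes "U \<in> carrier_mat n n" "V \<in> carrier_mat n n"
  shows "mat_adjoint (U * V) = mat_adjoint V * mat_adjoint U"
  using assms mat_adjoint_carrier[OF assms(1)] mat_adjoint_carrier[OF assms(2)] mat_adjoint_carrier[of "U * V" n n]
  by (intro eq_matI) (auto simp: index_mat_adjoint[of _ n n] scalar_prod_def ac_simps)

text \<open>Gram-Schmidt turns a basis starting with \<open>v\<close> into an orthogonal one whose vectors are then
  divided by their lengths.\<close>
lemma unitary_with_first_column:
  fixes v :: "complex vec"
  assumes v: "v \<in> carrier_vec n" and v0: "v \<noteq> 0\<^sub>v n" and n: "n \<noteq> 0"
  shows "\<exists>W\<in>carrier_mat n n. \<exists>c. mat_adjoint W * W = 1\<^sub>m n \<and> col W 0 = c \<cdot>\<^sub>v v"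
proof -
  define b where "b = basis_completion v"
  define ws where "ws = gram_schmidt n b"
  interpret cof_vec_space n "TYPE(complex)" .
  from basis_completion[OF v v0, folded b_def]
  have b: "distinct b" "\<not> lin_dep (set b)" "set b \<subseteq> carrier_vec n" "hd b = v" "length b = n"
    by auto
  from b(4,5) n obtain vs where bv: "b = v # vs" by (cases b) auto
  from gram_schmidt_result[OF b(3,1,2) refl, folded ws_def]
  have ws: "set ws \<subseteq> carrier_vec n" "corthogonal ws" "length ws = n"
    by (auto simp: b)
  have "hd ws = v"
    using gram_schmidt_hd[OF v, of vs, folded bv] unfolding ws_def .
  then have ws0: "ws ! 0 = v"
    using ws(3) n by (cases ws) auto
  have wsc: "ws ! i \<in> carrier_vec n" if "i < n" for i
    using ws that by auto
  define c where "c i = ws ! i \<bullet>c ws ! i" for i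
  have c: "0 < c i" if "i < n" for i
  proof -
    have "0 \<le> c i" "c i \<noteq> 0"
      using conjugate_square_ge_0_vec[of "ws ! i"] corthogonalD[OF ws(2), of i i] ws(3) that
      unfolding c_def by auto
    then show ?thesis by simp
  qed
  define s where "s i = complex_of_real (sqrt (Re (c i)))" for i
  have s: "cnj (s i) = s i" "s i * s i = c i" "s i \<noteq> 0" if "i < n" for i
    using c[OF that] unfolding s_def
    by (auto simp: less_complex_def less_eq_complex_def complex_eq_iff simp flip: of_real_mult)
  define W where "W = mat n n (\<lambda>(i, j). ws ! j $ i / s j)"
  have W: "W \<in> carrier_mat n n" unfolding W_def by simp
  have "mat_adjoint W * W = 1\<^sub>m n"
  proof (rule eq_matI)
    fix i j assume "i < dim_row (1\<^sub>m n :: complex mat)" "j < dim_col (1\<^sub>m n :: complex mat)"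
    then have ij: "i < n" "j < n" by auto
    have "(mat_adjoint W * W) $$ (i, j) = (\<Sum>k<n. ws ! j $ k * cnj (ws ! i $ k) / (s i * s j))"
      using ij s(1) by (subst index_adjoint_mult[OF W W]) (auto simp: W_def ac_simps intro!: sum.cong)
    also have "\<dots> = (ws ! j \<bullet>c ws ! i) / (s i * s j)"
      using wsc[OF ij(1)] wsc[OF ij(2)] by (simp add: scalar_prod_def sum_divide_distrib atLeast0LessThan)
    also have "\<dots> = (1\<^sub>m n :: complex mat) $$ (i, j)"
      using corthogonalD[OF ws(2), of j i] ws(3) ij s[OF ij(1)] by (auto simp: c_def)
    finally show "(mat_adjoint W * W) $$ (i, j) = (1\<^sub>m n :: complex mat) $$ (i, j)" .
  qed (use W mat_adjoint_carrier[OF W] in auto)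
  moreover have "col W 0 = (1 / s 0) \<cdot>\<^sub>v v"
    using n v ws0 unfolding W_def by (intro eq_vecI) auto
  ultimately show ?thesis using W by blast
qed

text \<open>By induction on the size: a unitary matrix whose first column is an eigenvector splits off a one
  by one block, since a Hermitian matrix whose first column vanishes below the diagonal also has a
  first row of that shape.\<close>
lemma hermitian_diagonalization:
  fixes A :: "complex mat"
  assumes "A \<in> carrier_mat n n" "mat_adjoint A = A"
  shows "\<exists>U\<in>carrier_mat n n. \<exists>d. mat_adjoint U * U = 1\<^sub>m n
    \<and> mat_adjoint U * A * U = mat n n (\<lambda>(i, j). if i = j then d i else 0)"
  using assms
proof (induction n arbitrary: A)
  case 0
  then show ?case
    by (intro bexI[of _ "1\<^sub>m 0"] conjI exI[of _ "\<lambda>_. 0"] eq_matI) (auto simp: mat_adjoint_def)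
next
  case (Suc m)
  let ?n = "Suc m"
  note A = Suc.prems(1)
  obtain e where "eigenvalue A e"
  proof -
    obtain es where "char_poly A = (\<Prod>e\<leftarrow>es. [:- e, 1:])" "length es = ?n"
      using char_poly_factorized[OF A] by blast
    then show thesis
      using that[of "hd es"] by (cases es) (auto simp: eigenvalue_root_char_poly[OF A])
  qed
  then obtain v where v: "v \<in> carrier_vec ?n" "v \<noteq> 0\<^sub>v ?n" "A *\<^sub>v v = e \<cdot>\<^sub>v v"
    using A unfolding eigenvalue_def eigenvector_def by auto
  obtain W c where W: "W \<in> carrier_mat ?n ?n" and WW: "mat_adjoint W * W = 1\<^sub>m ?n" and col: "col W 0 = c \<cdot>\<^sub>v v"
    using unitary_with_first_column[OF v(1,2)] by auto
  note W' = mat_adjoint_carrier[OF W]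
  define A' where "A' = mat_adjoint W * A * W"
  have A': "A' \<in> carrier_mat ?n ?n" unfolding A'_def using W W' A by auto
  have AA: "cnj (A $$ (i, j)) = A $$ (j, i)" if "i < ?n" "j < ?n" for i j
    using index_mat_adjoint[OF A that(2,1)] Suc.prems(2) by simp
  have herm: "cnj (A' $$ (i, j)) = A' $$ (j, i)" if "i < ?n" "j < ?n" for i j
    unfolding A'_def index_adjoint_mult_mult[OF W A W that] index_adjoint_mult_mult[OF W A W that(2,1)]
    by (subst sum.swap) (simp add: AA ac_simps)
  have col0: "A' $$ (i, 0) = (if i = 0 then e else 0)" if "i < ?n" for i
  proof -
    have "A *\<^sub>v col W 0 = e \<cdot>\<^sub>v col W 0"
      using col v A by (simp add: mult_mat_vec smult_smult_assoc mult.commute)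
    have "A' $$ (i, 0) = (mat_adjoint W * (A * W)) $$ (i, 0)"
      unfolding A'_def using W W' A by (simp add: assoc_mult_mat)
    also have "\<dots> = (\<Sum>k<?n. cnj (W $$ (k, i)) * (A *\<^sub>v col W 0) $ k)"
      using A W that by (subst index_adjoint_mult[OF W _ that]) (auto intro!: sum.cong)
    also have "\<dots> = e * (mat_adjoint W * W) $$ (i, 0)"
      unfolding \<open>A *\<^sub>v col W 0 = e \<cdot>\<^sub>v col W 0\<close>
      using W that by (subst index_adjoint_mult[OF W W that]) (auto simp: sum_distrib_left ac_simps simp del: sum.lessThan_Suc intro!: sum.cong)
    finally show ?thesis
      using that by (simp add: WW)
  qed
  have row0: "A' $$ (0, i) = (if i = 0 then e else 0)" if "i < ?n" for i
    using herm[of i 0] herm[of 0 0] col0[OF that] col0[of 0] that by auto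
  define A3 where "A3 = mat m m (\<lambda>(i, j). A' $$ (Suc i, Suc j))"
  have A3: "A3 \<in> carrier_mat m m" unfolding A3_def by simp
  have "mat_adjoint A3 = A3"
    using mat_adjoint_carrier[OF A3] A3
    by (intro eq_matI) (auto simp: index_mat_adjoint[OF A3], auto simp: A3_def herm)
  from Suc.IH[OF A3 this] obtain V d where V: "V \<in> carrier_mat m m"
    and VV: "mat_adjoint V * V = 1\<^sub>m m"
    and VAV: "mat_adjoint V * A3 * V = mat m m (\<lambda>(i, j). if i = j then d i else 0)"
    by blast
  have VV': "(\<Sum>k<m. cnj (V $$ (k, i)) * V $$ (k, j)) = (if i = j then 1 else 0)" if "i < m" "j < m" for i j
    using index_adjoint_mult[OF V V that] that VV by simp
  have VAV': "(\<Sum>k<m. \<Sum>l<m. cnj (V $$ (k, i)) * A' $$ (Suc k, Suc l) * V $$ (l, j)) = (if i = j then d i else 0)"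
    if "i < m" "j < m" for i j
    using index_adjoint_mult_mult[OF V A3 V that] that VAV by (simp add: A3_def)
  define P where "P = mat ?n ?n (\<lambda>(i, j). case (i, j) of (0, 0) \<Rightarrow> 1 | (Suc i, Suc j) \<Rightarrow> V $$ (i, j) | _ \<Rightarrow> 0)"
  have P: "P \<in> carrier_mat ?n ?n" unfolding P_def by simp
  have P_simps: "P $$ (0, 0) = 1" "\<And>i. i < m \<Longrightarrow> P $$ (Suc i, 0) = 0" "\<And>i. i < m \<Longrightarrow> P $$ (0, Suc i) = 0"
    "\<And>i j. i < m \<Longrightarrow> j < m \<Longrightarrow> P $$ (Suc i, Suc j) = V $$ (i, j)"
    unfolding P_def by auto
  note P' = mat_adjoint_carrier[OF P]
  have PP: "mat_adjoint P * P = 1\<^sub>m ?n"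
  proof (rule eq_matI)
    fix i j assume "i < dim_row (1\<^sub>m ?n :: complex mat)" "j < dim_col (1\<^sub>m ?n :: complex mat)"
    then have ij: "i < ?n" "j < ?n" by auto
    show "(mat_adjoint P * P) $$ (i, j) = (1\<^sub>m ?n :: complex mat) $$ (i, j)"
      using ij unfolding index_adjoint_mult[OF P P ij] sum.lessThan_Suc_shift
      by (cases i; cases j) (simp_all add: P_simps VV')
  qed (use P P' in auto)
  have PAP: "mat_adjoint P * A' * P = mat ?n ?n (\<lambda>(i, j). if i = j then case_nat e d i else 0)" (is "_ = ?D")
  proof (rule eq_matI)
    fix i j assume "i < dim_row ?D" "j < dim_col ?D"
    then have ij: "i < ?n" "j < ?n" by auto
    show "(mat_adjoint P * A' * P) $$ (i, j) = ?D $$ (i, j)"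
      using ij unfolding index_adjoint_mult_mult[OF P A' P ij] sum.lessThan_Suc_shift
      by (cases i; cases j) (simp_all add: P_simps VAV' row0 col0)
  qed (use P P' A' in auto)
  have PW: "mat_adjoint (W * P) = mat_adjoint P * mat_adjoint W"
    by (rule adjoint_mult[OF W P])
  have "mat_adjoint (W * P) * (W * P) = mat_adjoint P * (mat_adjoint W * W) * P"
    unfolding PW using W W' P P' by (simp add: assoc_mult_mat[of _ ?n ?n _ ?n _ ?n])
  also have "\<dots> = 1\<^sub>m ?n"
    unfolding WW using P P' PP by simp
  finally have "mat_adjoint (W * P) * (W * P) = 1\<^sub>m ?n" .
  moreover have "mat_adjoint (W * P) * A * (W * P) = ?D"
    unfolding PAP[symmetric] PW A'_def using W W' P P' A
    by (simp add: assoc_mult_mat[of _ ?n ?n _ ?n _ ?n])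
  moreover have "W * P \<in> carrier_mat ?n ?n" using W P by simp
  ultimately show ?case by blast
qed

section \<open>Nonnegativity of the coefficients\<close>

lemma psd_mat_kernel:
  assumes A: "A \<in> carrier_mat n n" and psd: "psd_mat A"
  shows "psd_kernel n (\<lambda>i j. A $$ (i, j))"
proof -
  have "A $$ (j, i) = cnj (A $$ (i, j))" if "i < n" "j < n" for i j
    using index_mat_adjoint[OF A that(2,1)] psd unfolding psd_mat_def hermitian_mat_def by simp
  moreover have "0 \<le> (\<Sum>i<n. \<Sum>j<n. cnj (v i) * A $$ (i, j) * v j)" for v
  proof -
    have "0 \<le> (A *\<^sub>v vec n v) \<bullet>c vec n v"
      using psd A unfolding psd_mat_def by auto
    also have "\<dots> = (\<Sum>i<n. \<Sum>j<n. cnj (v i) * A $$ (i, j) * v j)"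
      using A by (simp add: scalar_prod_def atLeast0LessThan sum_distrib_left sum_distrib_right ac_simps)
    finally show ?thesis .
  qed
  ultimately show ?thesis unfolding psd_kernel_def by blast
qed

lemma sum_swap_pairs:
  fixes f :: "'a \<Rightarrow> 'b \<Rightarrow> 'c \<Rightarrow> 'd \<Rightarrow> 'e :: comm_monoid_add"
  shows "(\<Sum>i\<in>I. \<Sum>j\<in>J. \<Sum>k\<in>K. \<Sum>l\<in>L. f i j k l) = (\<Sum>k\<in>K. \<Sum>l\<in>L. \<Sum>i\<in>I. \<Sum>j\<in>J. f i j k l)"
proof -
  have inner: "(\<Sum>i\<in>I. \<Sum>k\<in>K. \<Sum>l\<in>L. g i k l) = (\<Sum>k\<in>K. \<Sum>l\<in>L. \<Sum>i\<in>I. g i k l)" for I and g :: "_ \<Rightarrow> _ \<Rightarrow> _ \<Rightarrow> 'e"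
    by (subst sum.swap) (rule sum.cong[OF refl], rule sum.swap)
  show ?thesis
    unfolding inner[of _ J] by (rule inner)
qed

lemma psd_kernel_congruence:
  assumes U: "U \<in> carrier_mat n n" and A: "A \<in> carrier_mat n n"
    and psd: "psd_kernel n (\<lambda>i j. A $$ (i, j))"
  shows "psd_kernel n (\<lambda>i j. (mat_adjoint U * A * U) $$ (i, j))"
proof -
  note entry = index_adjoint_mult_mult[OF U A U]
  have herm: "cnj (A $$ (i, j)) = A $$ (j, i)" if "i < n" "j < n" for i j
    using psd that unfolding psd_kernel_def by metis
  have "(mat_adjoint U * A * U) $$ (j, i) = cnj ((mat_adjoint U * A * U) $$ (i, j))" if "i < n" "j < n" for i j
    unfolding entry[OF that] entry[OF that(2,1)]
    by (subst sum.swap) (simp add: herm ac_simps)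
  moreover have "0 \<le> (\<Sum>i<n. \<Sum>j<n. cnj (v i) * (mat_adjoint U * A * U) $$ (i, j) * v j)" for v
  proof -
    let ?w = "\<lambda>k. \<Sum>i<n. U $$ (k, i) * v i"
    let ?f = "\<lambda>i j k l. cnj (v i) * (cnj (U $$ (k, i)) * A $$ (k, l) * U $$ (l, j)) * v j"
    have "0 \<le> (\<Sum>k<n. \<Sum>l<n. cnj (?w k) * A $$ (k, l) * ?w l)"
      using psd unfolding psd_kernel_def by (elim conjE allE[of _ ?w])
    also have "\<dots> = (\<Sum>k<n. \<Sum>l<n. \<Sum>i<n. \<Sum>j<n. ?f i j k l)"
      by (simp add: sum_distrib_left sum_distrib_right ac_simps)
    also have "\<dots> = (\<Sum>i<n. \<Sum>j<n. \<Sum>k<n. \<Sum>l<n. ?f i j k l)"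
      by (rule sum_swap_pairs)
    also have "\<dots> = (\<Sum>i<n. \<Sum>j<n. cnj (v i) * (mat_adjoint U * A * U) $$ (i, j) * v j)"
      by (intro sum.cong refl) (simp add: entry sum_distrib_left sum_distrib_right)
    finally show ?thesis .
  qed
  ultimately show ?thesis unfolding psd_kernel_def by blast
qed

lemma mat_trace_mult_commute:
  fixes X Y :: "'a :: comm_ring_1 mat"
  assumes X: "X \<in> carrier_mat n n" and Y: "Y \<in> carrier_mat n n"
  shows "mat_trace (X * Y) = mat_trace (Y * X)"
proof -
  have "mat_trace (X * Y) = (\<Sum>i<n. \<Sum>k<n. X $$ (i, k) * Y $$ (k, i))"
    using X Y by (simp add: mat_trace_def scalar_prod_def atLeast0LessThan)
  also have "\<dots> = (\<Sum>k<n. \<Sum>i<n. Y $$ (k, i) * X $$ (i, k))"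
    by (subst sum.swap) (simp add: mult.commute)
  also have "\<dots> = mat_trace (Y * X)"
    using X Y by (simp add: mat_trace_def scalar_prod_def atLeast0LessThan)
  finally show ?thesis .
qed

lemma trace_pow_poly_unitary:
  assumes A: "A \<in> carrier_mat n n" and B: "B \<in> carrier_mat n n"
    and U: "U \<in> carrier_mat n n" and UU: "mat_adjoint U * U = 1\<^sub>m n"
  shows "trace_pow_poly (mat_adjoint U * A * U) (mat_adjoint U * B * U) p = trace_pow_poly A B p"
proof -
  note U' = mat_adjoint_carrier[OF U]
  have UU': "U * mat_adjoint U = 1\<^sub>m n"
    by (rule mat_mult_left_right_inverse[OF U' U UU])
  have "poly (trace_pow_poly (mat_adjoint U * A * U) (mat_adjoint U * B * U) p) t = poly (trace_pow_poly A B p) t" for t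
  proof -
    define N where "N = A + t \<cdot>\<^sub>m B"
    have N: "N \<in> carrier_mat n n" unfolding N_def using A B by auto
    note Np = pow_carrier_mat[OF N]
    have "mat_adjoint U * A * U + t \<cdot>\<^sub>m (mat_adjoint U * B * U) = mat_adjoint U * N * U"
      unfolding N_def using A B U U'
      by (simp add: mult_add_distrib_mat[of _ n n _ n] add_mult_distrib_mat[of _ n n _ _ n]
          mult_smult_distrib[of _ n n _ n] mult_smult_assoc_mat[of _ n n _ n])
    moreover have "similar_mat_wit (mat_adjoint U * N * U) N (mat_adjoint U) U"
      by (rule similar_mat_witI[OF UU UU' refl _ N U' U]) (use U U' N in auto)
    ultimately have "poly (trace_pow_poly (mat_adjoint U * A * U) (mat_adjoint U * B * U) p) t
        = mat_trace (mat_adjoint U * N ^\<^sub>m p * U)"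
      using similar_mat_wit_pow_id[of _ N "mat_adjoint U" U p] A B U U'
      by (subst poly_trace_pow_poly[of _ n]) auto
    also have "\<dots> = mat_trace (U * (mat_adjoint U * N ^\<^sub>m p))"
      using U U' Np[of p] by (intro mat_trace_mult_commute[of _ n]) auto
    also have "U * (mat_adjoint U * N ^\<^sub>m p) = N ^\<^sub>m p"
      using U U' Np[of p] UU' left_mult_one_mat[OF Np[of p]]
      by (simp flip: assoc_mult_mat[of _ n n _ n _ n])
    finally show ?thesis
      unfolding poly_trace_pow_poly[OF A B] N_def .
  qed
  then show ?thesis by (simp add: poly_eq_poly_eq_iff[symmetric] fun_eq_iff)
qed

lemma coeff_trace_pow_poly_swap:
  assumes "A \<in> carrier_mat n n" "B \<in> carrier_mat n n" "r \<le> p"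
  shows "coeff (trace_pow_poly A B p) r = coeff (trace_pow_poly B A p) (p - r)"
  using assms by (simp add: coeff_trace_pow_poly word_sum_swap[of r p])

lemma coeff_trace_pow_poly_nonneg:
  assumes A: "A \<in> carrier_mat n n" and B: "B \<in> carrier_mat n n"
    and psd: "psd_mat A" "psd_mat B"
    and r: "r \<le> 2 \<or> r = 3 \<and> (p = 6 \<or> p = 7)"
  shows "0 \<le> coeff (trace_pow_poly A B p) r"
proof -
  have "mat_adjoint A = A"
    using psd(1) unfolding psd_mat_def hermitian_mat_def by simp
  from hermitian_diagonalization[OF A this] obtain U d where U: "U \<in> carrier_mat n n"
    and UU: "mat_adjoint U * U = 1\<^sub>m n"
    and D: "mat_adjoint U * A * U = mat n n (\<lambda>(i, j). if i = j then d i else 0)"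
    by blast
  note U' = mat_adjoint_carrier[OF U]
  define b where "b i j = (mat_adjoint U * B * U) $$ (i, j)" for i j
  define a where "a i = (if i < n then Re (d i) else 0)" for i
  have d: "0 \<le> d i" if "i < n" for i
    using psd_kernel_diag_nonneg[OF psd_kernel_congruence[OF U A psd_mat_kernel[OF A psd(1)]] that]
    unfolding D using that by simp
  then have a: "0 \<le> a i" for i
    unfolding a_def by (simp add: less_eq_complex_def)
  have diag: "(mat_adjoint U * A * U) $$ (i, j) = diag a i j" if "i < n" "j < n" for i j
    using d[OF that(1)] that unfolding D diag_def a_def by (auto simp: less_eq_complex_def complex_eq_iff)
  have "coeff (trace_pow_poly A B p) r = (\<Sum>x<n. word_sum n (diag a) b p r x x)"
    unfolding trace_pow_poly_unitary[OF A B U UU, symmetric]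
    by (subst coeff_trace_pow_poly[of _ n]) (use U U' A B in \<open>auto simp: b_def[symmetric] simp del: assoc_mult_mat intro!: sum.cong word_sum_cong diag\<close>)
  also have "0 \<le> \<dots>"
    using psd_kernel_congruence[OF U B psd_mat_kernel[OF B psd(2)]] unfolding b_def[symmetric]
    by (intro trace_word_sum_diag_nonneg a r)
  finally show ?thesis .
qed

theorem mainTheorem2:
  fixes n p :: nat and A B :: "complex mat"
  assumes "n \<ge> 1"
    and "A \<in> carrier_mat n n" and "B \<in> carrier_mat n n"
    and "psd_mat A" and "psd_mat B"
    and "1 \<le> p" and "p \<le> 7"
  shows "\<forall>r. coeff (trace_pow_poly A B p) r \<in> \<real> \<and> 0 \<le> Re (coeff (trace_pow_poly A B p) r)"
proof
  fix r
  let ?low = "\<lambda>r. r \<le> 2 \<or> r = 3 \<and> (p = 6 \<or> p = 7)"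
  have "0 \<le> coeff (trace_pow_poly A B p) r"
  proof (cases "r \<le> p")
    case True
    \<comment> \<open>exchanging \<open>A\<close> and \<open>B\<close> reverses the list of coefficients\<close>
    then have "?low r \<or> ?low (p - r)"
      using assms(7) by presburger
    then show ?thesis
      using coeff_trace_pow_poly_nonneg[OF assms(2-5), of r p]
        coeff_trace_pow_poly_nonneg[OF assms(3,2,5,4), of "p - r" p]
        coeff_trace_pow_poly_swap[OF assms(2,3) True] by auto
  next
    case False
    then show ?thesis
      by (simp add: coeff_trace_pow_poly[OF assms(2,3)] word_sum_eq_0)
  qed
  then show "coeff (trace_pow_poly A B p) r \<in> \<real> \<and> 0 \<le> Re (coeff (trace_pow_poly A B p) r)"
    by (simp add: less_eq_complex_def complex_is_Real_iff)
qed

end
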